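(* Let $D$ be a positive integer with $D\not\equiv 0\pmod 4$, let $\mathbb{I}=\mathbb{Q}(\sqrt{-D})$ and let $\mathbb{Z}_{\mathbb{I}}$ be its ring of integers. Let $\Theta_1,\dots,\Theta_m\in\mathbb{C}$ and $H_1,\dots,H_m\in\mathbb{Z}_{\ge 1}$ be given. Then there exists a non-zero vector $(\beta_0,\beta_1,\dots,\beta_m)\in\mathbb{Z}_{\mathbb{I}}^{m+1}\setminus\{\overline{0}\}$ with $|\beta_j|\le H_j$ for all $j=1,\dots,m$, satisfying $$|\beta_0+\beta_1\Theta_1+\dots+\beta_m\Theta_m|\le \left(\frac{2^{\tau}D^{1/4}}{\sqrt{\pi}}\right)^{m+1}\frac{1}{H_1\cdots H_m},$$ where $\tau=1$ if $D\equiv 1$ or $2\pmod 4$, and $\tau=1/2$ if $D\equiv 3\pmod 4$. *)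

theory Defs
  imports "HOL-Analysis.Analysis" "HOL-Computational_Algebra.Polynomial"
begin

definition is_subfield :: "complex set \<Rightarrow> bool" where
  "is_subfield K \<longleftrightarrow> 0 \<in> K \<and> 1 \<in> K \<and>
     (\<forall>x\<in>K. \<forall>y\<in>K. x + y \<in> K \<and> x * y \<in> K) \<and>
     (\<forall>x\<in>K. - x \<in> K \<and> inverse x \<in> K)"

text \<open>The field \<open>\<rat>(\<alpha>)\<close>. Every subfield of \<open>\<complex>\<close> contains \<open>\<rat>\<close>, so
  \<open>\<rat> \<subseteq> K\<close> need not be required.\<close>

definition rat_adjoin :: "complex \<Rightarrow> complex set" where
  "rat_adjoin \<alpha> = \<Inter>{K. is_subfield K \<and> \<alpha> \<in> K}"

definition ring_of_integers :: "complex set \<Rightarrow> complex set" where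
  "ring_of_integers K = {x \<in> K. algebraic_int x}"

definition imag_quadratic_field :: "nat \<Rightarrow> complex set" where
  "imag_quadratic_field D = rat_adjoin (csqrt (- of_nat D))"

text \<open>Only meaningful when 4 does not divide \<open>D\<close>; the last case is then
  \<open>D mod 4 = 3\<close>.\<close>

definition tau :: "nat \<Rightarrow> real" where
  "tau D = (if D mod 4 = 1 \<or> D mod 4 = 2 then 1 else 1 / 2)"

end

theory Submission
  imports Defs
begin

text \<open>
  This is Minkowski's theorem for a product of discs, but the product structure reduces everything
  to areas in the plane. Put \<open>\<Lambda> = \<int> + \<int>\<omega>\<close>, of covolume \<open>Im \<omega>\<close>, with \<open>\<omega> = \<surd>(-D)\<close> or
  \<open>\<omega> = (1 + \<surd>(-D))/2\<close>. By averaging over translates, for each \<open>j\<close> some disc of radius \<open>H\<^sub>j/2\<close>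
  contains at least \<open>\<pi>H\<^sub>j\<^sup>2/(4 Im \<omega>)\<close> points of \<open>\<Lambda>\<close>. Let \<open>B\<close> be the product of these point sets
  and \<open>R\<close> the claimed bound. The discs of radius slightly larger than \<open>R/2\<close> about the values
  \<open>\<Sum>j. b\<^sub>j\<Theta>\<^sub>j\<close>, \<open>b \<in> B\<close>, have total area exceeding \<open>Im \<omega>\<close>, so two of them overlap modulo
  \<open>\<Lambda>\<close>; the difference of the two points of \<open>B\<close>, completed by a suitable \<open>\<beta>\<^sub>0 \<in> \<Lambda>\<close>, is the
  required vector.
\<close>

section \<open>A measure-theoretic pigeonhole principle\<close>

text \<open>Integrate the number of sets \<open>G j\<close> containing x: it is at most
  \<open>k\<close> on \<open>F\<close> and zero elsewhere.\<close>

lemma sum_measure_le_card_bound: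
  assumes "finite J" and F: "F \<in> fmeasurable M"
    and G: "\<And>j. j \<in> J \<Longrightarrow> G j \<in> sets M" "\<And>j. j \<in> J \<Longrightarrow> G j \<subseteq> F"
    and card: "\<And>x. x \<in> F \<Longrightarrow> card {j \<in> J. x \<in> G j} \<le> k"
  shows "(\<Sum>j\<in>J. measure M (G j)) \<le> real k * measure M F"
proof -
  have fin: "G j \<in> fmeasurable M" if "j \<in> J" for j
    using fmeasurableI2[OF F] G that by blast
  have "(\<Sum>j\<in>J. measure M (G j)) = (\<Sum>j\<in>J. \<integral>x. indicator (G j) x \<partial>M)"
    by (intro sum.cong refl) (use G sets.sets_into_space in \<open>auto simp: Int_absorb2\<close>)
  also have "\<dots> = (\<integral>x. (\<Sum>j\<in>J. indicator (G j) x) \<partial>M)"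
    by (rule Bochner_Integration.integral_sum[symmetric])
      (use fin in \<open>auto simp: fmeasurable_def\<close>)
  also have "\<dots> \<le> (\<integral>x. real k * indicator F x \<partial>M)"
  proof (rule integral_mono)
    fix x
    have eq: "(\<Sum>j\<in>J. indicator (G j) x :: real) = real (card {j \<in> J. x \<in> G j})"
      using \<open>finite J\<close> by (simp add: indicator_def sum.If_cases Int_def)
    show "(\<Sum>j\<in>J. indicator (G j) x) \<le> real k * indicator F x"
    proof (cases "x \<in> F")
      case True
      then show ?thesis using card eq by simp
    next
      case False
      then have "{j \<in> J. x \<in> G j} = {}" using G by auto
      then show ?thesis using eq by (metis card.empty False indicator_simps(2) mult_zero_right of_nat_0 order_refl)
    qed
  qed (use fin F in \<open>auto simp: fmeasurable_def intro!: Bochner_Integration.integrable_sum\<close>)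
  also have "\<dots> = real k * measure M F"
    using F sets.sets_into_space by (auto simp: fmeasurable_def Int_absorb2)
  finally show ?thesis .
qed

section \<open>The lattice and its fundamental domain\<close>

definition lat_pt :: "complex \<Rightarrow> int \<times> int \<Rightarrow> complex" where
  "lat_pt \<omega> p = of_int (fst p) + of_int (snd p) * \<omega>"

definition int_span :: "complex \<Rightarrow> complex set" where
  "int_span \<omega> = range (lat_pt \<omega>)"

lemma lat_pt_diff: "lat_pt \<omega> p - lat_pt \<omega> q = lat_pt \<omega> (p - q)"
  by (simp add: lat_pt_def algebra_simps)

lemma int_span_diff: "x \<in> int_span \<omega> \<Longrightarrow> y \<in> int_span \<omega> \<Longrightarrow> x - y \<in> int_span \<omega>"
  by (auto simp: int_span_def lat_pt_diff)

lemma inj_lat_pt: "Im \<omega> > 0 \<Longrightarrow> inj (lat_pt \<omega>)"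
  by (auto simp: inj_on_def lat_pt_def complex_eq_iff)

text \<open>A bound on the imaginary part of a + b\<omega> bounds b, and then the real part bounds
  a, so the coordinates lie in a finite box.\<close>

lemma finite_lat_pt_vimage:
  assumes \<omega>: "Im \<omega> > 0" and "bounded S"
  shows "finite (lat_pt \<omega> -` S)"
proof -
  obtain B where B: "\<And>z. z \<in> S \<Longrightarrow> cmod z \<le> B"
    using \<open>bounded S\<close> by (auto simp: bounded_iff)
  define M where "M = B / Im \<omega>"
  define N where "N = B + M * \<bar>Re \<omega>\<bar>"
  have "p \<in> {- \<lceil>N\<rceil>..\<lceil>N\<rceil>} \<times> {- \<lceil>M\<rceil>..\<lceil>M\<rceil>}" if "lat_pt \<omega> p \<in> S" for p
  proof -
    obtain a b where p: "p = (a, b)" by force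
    have n: "cmod (lat_pt \<omega> p) \<le> B" using B that by blast
    have "\<bar>of_int b * Im \<omega>\<bar> \<le> B"
      using n abs_Im_le_cmod[of "lat_pt \<omega> p"] by (simp add: p lat_pt_def)
    then have b: "\<bar>of_int b\<bar> \<le> M"
      using \<omega> by (simp add: M_def abs_mult pos_le_divide_eq)
    have "\<bar>of_int a + of_int b * Re \<omega>\<bar> \<le> B"
      using n abs_Re_le_cmod[of "lat_pt \<omega> p"] by (simp add: p lat_pt_def)
    moreover have "\<bar>of_int b * Re \<omega>\<bar> \<le> M * \<bar>Re \<omega>\<bar>"
      using b by (simp add: abs_mult mult_right_mono)
    ultimately have "\<bar>of_int a\<bar> \<le> N" by (simp add: N_def)
    with b show ?thesis by (auto simp: p) linarith+
  qed
  then have "lat_pt \<omega> -` S \<subseteq> {- \<lceil>N\<rceil>..\<lceil>N\<rceil>} \<times> {- \<lceil>M\<rceil>..\<lceil>M\<rceil>}" by blast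
  then show ?thesis by (rule finite_subset) simp
qed

text \<open>A rectangle instead of the parallelogram on 1 and \<omega>: its translates still tile
  the plane, in rows shifted by \<open>Re \<omega>\<close>, and its area is a plain product. It is
  half-open to make representatives unique.\<close>

definition fund_rect :: "complex \<Rightarrow> complex set" where
  "fund_rect \<omega> = {z. 0 \<le> Re z \<and> Re z < 1 \<and> 0 \<le> Im z \<and> Im z < Im \<omega>}"

lemma fund_rect_subset_cbox: "fund_rect \<omega> \<subseteq> cbox 0 (Complex 1 (Im \<omega>))"
  by (auto simp: fund_rect_def in_cbox_complex_iff)

lemma lmeasurable_fund_rect: "fund_rect \<omega> \<in> lmeasurable"
proof (rule fmeasurableI2[OF _ fund_rect_subset_cbox])
  have "fund_rect \<omega> \<in> sets borel"
    unfolding fund_rect_def by measurable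
  then show "fund_rect \<omega> \<in> sets lebesgue" by simp
qed auto

lemma measure_fund_rect_le:
  assumes "Im \<omega> > 0"
  shows "measure lebesgue (fund_rect \<omega>) \<le> Im \<omega>"
proof -
  have "measure lebesgue (fund_rect \<omega>) \<le> measure lebesgue (cbox 0 (Complex 1 (Im \<omega>)))"
    by (intro measure_mono_fmeasurable fund_rect_subset_cbox) (use lmeasurable_fund_rect in auto)
  also have "\<dots> = Im \<omega>"
    using assms by (subst measure_completion, simp, subst content_cbox')
      (auto simp: Basis_complex_def inner_complex_def cbox_def intro!: exI[of _ 0])
  finally show ?thesis .
qed

lemma bounded_fund_rect: "bounded (fund_rect \<omega>)"
  by (rule bounded_subset[OF bounded_cbox fund_rect_subset_cbox])

text \<open>The imaginary part determines b as a floor; after subtracting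
  \<open>b * Re \<omega>\<close>, the real part determines a in the same way.\<close>

lemma ex1_lat_pt_fund_rect:
  assumes "Im \<omega> > 0"
  shows "\<exists>!p. z - lat_pt \<omega> p \<in> fund_rect \<omega>"
proof -
  have iff: "z - lat_pt \<omega> (a, b) \<in> fund_rect \<omega> \<longleftrightarrow>
      b = \<lfloor>Im z / Im \<omega>\<rfloor> \<and> a = \<lfloor>Re z - of_int b * Re \<omega>\<rfloor>" for a b
  proof -
    have "b = \<lfloor>Im z / Im \<omega>\<rfloor> \<longleftrightarrow> of_int b * Im \<omega> \<le> Im z \<and> Im z < (of_int b + 1) * Im \<omega>"
      using assms by (metis floor_eq_iff pos_divide_less_eq pos_le_divide_eq)
    moreover have "a = \<lfloor>Re z - of_int b * Re \<omega>\<rfloor> \<longleftrightarrow>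
        of_int a \<le> Re z - of_int b * Re \<omega> \<and> Re z - of_int b * Re \<omega> < of_int a + 1"
      by (metis floor_eq_iff)
    ultimately show ?thesis
      by (auto simp: fund_rect_def lat_pt_def algebra_simps)
  qed
  then show ?thesis by (metis old.prod.exhaust)
qed

section \<open>Blichfeldt's principle for a family of plane sets\<close>

text \<open>Cut each \<open>E i\<close> along the translates of the fundamental domain and move all
  pieces back into it. Their total area exceeds \<open>k\<close> times the area of the domain, so
  some t lies in more than \<open>k\<close> pieces. Recording pairs (i, l) counts overlaps between
  different \<open>E i\<close> and within a single one alike.\<close>

lemma overlapping_translates:
  assumes \<omega>: "Im \<omega> > 0" and "finite I"
    and E: "\<And>i. i \<in> I \<Longrightarrow> E i \<in> lmeasurable" "\<And>i. i \<in> I \<Longrightarrow> bounded (E i)"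
    and big: "real k * Im \<omega> < (\<Sum>i\<in>I. measure lebesgue (E i))"
  shows "\<exists>t S. finite S \<and> k < card S \<and> S \<subseteq> {(i, l). i \<in> I \<and> l \<in> int_span \<omega> \<and> t + l \<in> E i}"
proof -
  define F where "F = fund_rect \<omega>"
  \<comment> \<open>\<open>P\<close> indexes the translates of \<open>F\<close> that meet some
    \<open>E i\<close>, and \<open>G (i, p)\<close> is the part of \<open>E i\<close> in the
    translate by p, moved back to \<open>F\<close>.\<close>
  define P where "P = lat_pt \<omega> -` (\<Union>x\<in>(\<Union>i\<in>I. E i). \<Union>y\<in>F. {x - y})"
  define G where "G = (\<lambda>(i, p). {x \<in> F. x + lat_pt \<omega> p \<in> E i})"
  have "finite P"
    unfolding P_def F_def using \<open>finite I\<close> E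
    by (intro finite_lat_pt_vimage[OF \<omega>] bounded_differences bounded_UN bounded_fund_rect) auto
  have G_lm: "G (i, p) \<in> lmeasurable" if "i \<in> I" for i p
  proof -
    have "G (i, p) = F \<inter> (\<lambda>x. x - lat_pt \<omega> p) ` E i"
      by (force simp: G_def image_iff)
    then show ?thesis
      using E that by (simp add: F_def lmeasurable_fund_rect fmeasurable.Int measurable_translation_subtract)
  qed
  \<comment> \<open>Existence of a representative in \<open>F\<close> makes the translated pieces
    cover \<open>E i\<close>; its uniqueness makes them disjoint.\<close>
  have split: "measure lebesgue (E i) = (\<Sum>p\<in>P. measure lebesgue (G (i, p)))" if i: "i \<in> I" for i
  proof -
    have cover: "E i = (\<Union>p\<in>P. (+) (lat_pt \<omega> p) ` G (i, p))"
    proof (intro equalityI subsetI)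
      fix z assume z: "z \<in> E i"
      obtain p where p: "z - lat_pt \<omega> p \<in> F"
        using ex1_lat_pt_fund_rect[OF \<omega>, of z] by (auto simp: F_def)
      have "lat_pt \<omega> p = z - (z - lat_pt \<omega> p)" by simp
      then have "p \<in> P" using z i p unfolding P_def by blast
      then show "z \<in> (\<Union>p\<in>P. (+) (lat_pt \<omega> p) ` G (i, p))"
        using p z by (auto simp: G_def image_iff intro!: bexI[of _ p] exI[of _ "z - lat_pt \<omega> p"])
    qed (auto simp: G_def add.commute)
    have "disjoint_family_on (\<lambda>p. (+) (lat_pt \<omega> p) ` G (i, p)) P"
      unfolding disjoint_family_on_def
    proof (intro ballI impI)
      fix p q :: "int \<times> int" assume "p \<noteq> q"
      have "z - lat_pt \<omega> p' \<in> F" if "z \<in> (+) (lat_pt \<omega> p') ` G (i, p')" for z p'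
        using that by (auto simp: G_def)
      with \<open>p \<noteq> q\<close> show "(+) (lat_pt \<omega> p) ` G (i, p) \<inter> (+) (lat_pt \<omega> q) ` G (i, q) = {}"
        using ex1_lat_pt_fund_rect[OF \<omega>] unfolding F_def by blast
    qed
    moreover have "(+) (lat_pt \<omega> p) ` G (i, p) \<in> lmeasurable" for p
      using G_lm[OF i] by (rule measurable_translation)
    ultimately have "measure lebesgue (E i) = (\<Sum>p\<in>P. measure lebesgue ((+) (lat_pt \<omega> p) ` G (i, p)))"
      unfolding cover using \<open>finite P\<close>
      by (intro measure_UNION') (auto simp: disjoint_family_on_def pairwise_def disjnt_def)
    then show ?thesis by (simp add: measure_translation)
  qed
  have "real k * measure lebesgue F < (\<Sum>j\<in>I \<times> P. measure lebesgue (G j))"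
  proof -
    have "real k * measure lebesgue F \<le> real k * Im \<omega>"
      unfolding F_def using measure_fund_rect_le[OF \<omega>] by (intro mult_left_mono) auto
    also note big
    also have "(\<Sum>i\<in>I. measure lebesgue (E i)) = (\<Sum>j\<in>I \<times> P. measure lebesgue (G j))"
      by (simp add: split sum.cartesian_product cong: sum.cong)
    finally show ?thesis .
  qed
  then have "\<exists>t. k < card {j \<in> I \<times> P. t \<in> G j}"
  proof (rule contrapos_pp)
    assume "\<nexists>t. k < card {j \<in> I \<times> P. t \<in> G j}"
    then have "(\<Sum>j\<in>I \<times> P. measure lebesgue (G j)) \<le> real k * measure lebesgue F"
      using \<open>finite I\<close> \<open>finite P\<close> G_lm lmeasurable_fund_rect[of \<omega>]
      by (intro sum_measure_le_card_bound) (auto simp: F_def G_def not_less)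
    then show "\<not> real k * measure lebesgue F < (\<Sum>j\<in>I \<times> P. measure lebesgue (G j))"
      by simp
  qed
  then obtain t where t: "k < card {j \<in> I \<times> P. t \<in> G j}" ..
  define S where "S = map_prod id (lat_pt \<omega>) ` {j \<in> I \<times> P. t \<in> G j}"
  have "inj (map_prod id (lat_pt \<omega>))"
    using inj_lat_pt[OF \<omega>] by (simp add: prod.inj_map)
  then have "card S = card {j \<in> I \<times> P. t \<in> G j}"
    unfolding S_def by (intro card_image) (auto intro: inj_on_subset)
  moreover have "finite S" unfolding S_def using \<open>finite I\<close> \<open>finite P\<close> by simp
  moreover have "S \<subseteq> {(i, l). i \<in> I \<and> l \<in> int_span \<omega> \<and> t + l \<in> E i}"
    by (auto simp: S_def G_def int_span_def)
  ultimately show ?thesis using t by (intro exI[of _ t] exI[of _ S]) simp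
qed

section \<open>Discs and lattice points\<close>

lemma measure_cball_complex: "r \<ge> 0 \<Longrightarrow> measure lborel (cball (c :: complex) r) = pi * r\<^sup>2"
  by (simp add: content_cball unit_ball_vol_2)

text \<open>The overlap principle is applied to a one-member family, the disc about 0: more than
  \<open>k\<close> lattice points l have t + l in it, hence lie in the disc about -t.\<close>

lemma disc_with_many_lattice_points:
  assumes \<omega>: "Im \<omega> > 0" and "r > 0"
  shows "\<exists>t A. finite A \<and> A \<subseteq> int_span \<omega> \<inter> cball t r \<and> pi * r\<^sup>2 / Im \<omega> \<le> card A"
proof -
  define a where "a = pi * r\<^sup>2 / Im \<omega>"
  have "a > 0" using assms by (simp add: a_def)
  \<comment> \<open>The largest integer strictly below \<open>a\<close>: this meets the strict area
    hypothesis, while \<open>k + 1\<close> points still number at least \<open>a\<close>.\<close>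
  define k where "k = nat (\<lceil>a\<rceil> - 1)"
  have "real k < a" "a \<le> real k + 1" using \<open>a > 0\<close> unfolding k_def by linarith+
  then have "real k * Im \<omega> < (\<Sum>i\<in>{()}. measure lebesgue (cball 0 r :: complex set))"
    using assms by (simp add: measure_cball_complex a_def pos_less_divide_eq)
  then obtain t S where S: "finite S" "k < card S"
      "S \<subseteq> {(i, l). i \<in> {()} \<and> l \<in> int_span \<omega> \<and> t + l \<in> cball 0 r}"
    using overlapping_translates[OF \<omega>, of "{()}" "\<lambda>_. cball 0 r" k] by auto
  have "inj_on snd S" by (auto simp: inj_on_def)
  then have "card (snd ` S) = card S" by (rule card_image)
  moreover have "snd ` S \<subseteq> int_span \<omega> \<inter> cball (- t) r"
  proof -
    have "dist (- t) l = cmod (t + l)" for l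
      by (metis dist_norm diff_minus_eq_add add.commute norm_minus_commute)
    then show ?thesis using S(3) by auto
  qed
  ultimately show ?thesis
    using S \<open>a \<le> real k + 1\<close> unfolding a_def
    by (intro exI[of _ "- t"] exI[of _ "snd ` S"]) auto
qed

text \<open>The bound for strictly larger radii passes to the limit because only finitely many
  lattice points are involved.\<close>

lemma small_value_lattice_translate:
  assumes \<omega>: "Im \<omega> > 0" and "finite B" and "R \<ge> 0"
    and big: "Im \<omega> \<le> real (card B) * (pi * (R / 2)\<^sup>2)"
  shows "\<exists>x\<in>B. \<exists>y\<in>B. \<exists>l\<in>int_span \<omega>. (x \<noteq> y \<or> l \<noteq> 0) \<and> cmod (l + f x - f y) \<le> R"
proof -
  define T where "T = {(x, y, l). x \<in> B \<and> y \<in> B \<and> l \<in> int_span \<omega> \<and> (x \<noteq> y \<or> l \<noteq> 0) \<and>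
    cmod (l + f x - f y) \<le> R + 1}"
  define g where "g = (\<lambda>(x, y, l). cmod (l + f x - f y))"
  \<comment> \<open>Enlarging the radius to \<open>R' / 2\<close> makes the area inequality strict,
    so two distinct pairs (x, l) and (y, l') share a t. Subtracting their two disc conditions
    eliminates t, and distinctness of the pairs says that x and y differ or l' - l is
    nonzero.\<close>
  have close: "\<exists>u\<in>T. g u \<le> R'" if "R < R'" "R' \<le> R + 1" for R'
  proof -
    have "B \<noteq> {}" using big \<omega> by auto
    then have "real (card B) > 0" using \<open>finite B\<close> by (simp add: card_gt_0_iff)
    moreover have "(R / 2)\<^sup>2 < (R' / 2)\<^sup>2"
      using that \<open>R \<ge> 0\<close> by (intro power_strict_mono) auto
    ultimately have "Im \<omega> < real (card B) * (pi * (R' / 2)\<^sup>2)"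
      using big by (smt (verit) mult_strict_left_mono pi_gt_zero)
    then have "real 1 * Im \<omega> < (\<Sum>x\<in>B. measure lebesgue (cball (f x) (R' / 2)))"
      using that \<open>R \<ge> 0\<close> by (simp add: measure_cball_complex)
    then obtain t S where S: "finite S" "1 < card S"
        "S \<subseteq> {(x, l). x \<in> B \<and> l \<in> int_span \<omega> \<and> t + l \<in> cball (f x) (R' / 2)}"
      using overlapping_translates[OF \<omega> \<open>finite B\<close>, of "\<lambda>x. cball (f x) (R' / 2)" 1] by auto
    obtain u w where "u \<in> S" "w \<in> S" "u \<noteq> w"
      using S(1,2) by (metis One_nat_def card_le_Suc0_iff_eq not_less)
    moreover obtain x l y l' where uw: "u = (x, l)" "w = (y, l')" by force
    ultimately have "(x, l) \<noteq> (y, l')" and xy: "x \<in> B" "y \<in> B" "l \<in> int_span \<omega>" "l' \<in> int_span \<omega>"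
      and d: "cmod (f x - (t + l)) \<le> R' / 2" "cmod (f y - (t + l')) \<le> R' / 2"
      using S(3) by (auto simp: dist_norm)
    have "cmod ((f x - (t + l)) - (f y - (t + l'))) \<le> R'"
      using norm_triangle_ineq4[of "f x - (t + l)" "f y - (t + l')"] d by linarith
    also have "(f x - (t + l)) - (f y - (t + l')) = (l' - l) + f x - f y"
      by simp
    finally have le: "cmod ((l' - l) + f x - f y) \<le> R'" .
    then have "(x, y, l' - l) \<in> T"
      using xy \<open>(x, l) \<noteq> (y, l')\<close> that by (auto simp: T_def int_span_diff)
    with le show ?thesis by (intro bexI[of _ "(x, y, l' - l)"]) (auto simp: g_def)
  qed
  have "finite T"
  proof -
    define P where "P = lat_pt \<omega> -` (\<Union>x\<in>B. \<Union>y\<in>B. cball (f y - f x) (R + 1))"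
    have "finite P"
      unfolding P_def using \<open>finite B\<close> by (intro finite_lat_pt_vimage[OF \<omega>] bounded_UN) auto
    moreover have "T \<subseteq> B \<times> B \<times> lat_pt \<omega> ` P"
    proof
      fix u assume "u \<in> T"
      then obtain x y p where u: "u = (x, y, lat_pt \<omega> p)" "x \<in> B" "y \<in> B"
          "cmod (lat_pt \<omega> p + f x - f y) \<le> R + 1"
        by (auto simp: T_def int_span_def)
      have "dist (f y - f x) (lat_pt \<omega> p) = cmod (lat_pt \<omega> p + f x - f y)"
        by (simp add: dist_norm norm_minus_commute algebra_simps)
      then have "p \<in> P" using u(2-) unfolding P_def by (metis UN_I mem_cball vimageI2)
      then show "u \<in> B \<times> B \<times> lat_pt \<omega> ` P" using u by auto
    qed
    ultimately show ?thesis using \<open>finite B\<close> finite_subset by blast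
  qed
  moreover have "T \<noteq> {}" using close[of "R + 1"] by auto
  ultimately obtain u where u: "u \<in> T" "\<And>w. w \<in> T \<Longrightarrow> g u \<le> g w"
    by (metis arg_min_on_def arg_min_if_finite(1) arg_min_least)
  have "g u \<le> R"
  proof (rule ccontr)
    assume "\<not> g u \<le> R"
    \<comment> \<open>The midpoint lies strictly above \<open>R\<close> and strictly below both
      \<open>g u\<close> and \<open>R + 1\<close>, so \<open>close\<close> yields an element of
      \<open>T\<close> that beats the minimum.\<close>
    define R' where "R' = (R + min (g u) (R + 1)) / 2"
    have "R < R'" "R' \<le> R + 1" "R' < g u"
      using \<open>\<not> g u \<le> R\<close> unfolding R'_def by (auto simp: min_def)
    then show False using close[of R'] u(2) by force
  qed
  with u(1) show ?thesis by (auto simp: T_def g_def)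
qed

section \<open>Small values of a linear form over the lattice\<close>

lemma linear_form_small_value:
  fixes \<Theta> :: "nat \<Rightarrow> complex" and h :: "nat \<Rightarrow> real"
  assumes \<omega>: "Im \<omega> > 0" and h: "\<And>j. j \<in> {1..m} \<Longrightarrow> h j > 0"
  shows "\<exists>\<beta>. (\<forall>j\<in>{0..m}. \<beta> j \<in> int_span \<omega>) \<and> (\<exists>j\<in>{0..m}. \<beta> j \<noteq> 0) \<and>
      (\<forall>j\<in>{1..m}. cmod (\<beta> j) \<le> h j) \<and>
      cmod (\<beta> 0 + (\<Sum>j=1..m. \<beta> j * \<Theta> j)) \<le> (2 * sqrt (Im \<omega>) / sqrt pi) ^ (m + 1) * (1 / (\<Prod>j=1..m. h j))"
proof -
  define R where "R = (2 * sqrt (Im \<omega>) / sqrt pi) ^ (m + 1) * (1 / (\<Prod>j=1..m. h j))"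
  define f where "f = (\<lambda>b. \<Sum>j=1..m. b j * \<Theta> j)"
  have hprod_pos: "(\<Prod>j=1..m. h j) > 0" using h by (intro prod_pos) auto
  have "R \<ge> 0" using \<omega> hprod_pos by (simp add: R_def)
  have "\<forall>j\<in>{1..m}. \<exists>t A. finite A \<and> A \<subseteq> int_span \<omega> \<inter> cball t (h j / 2) \<and>
      pi * (h j / 2)\<^sup>2 / Im \<omega> \<le> card A"
    using h by (intro ballI disc_with_many_lattice_points[OF \<omega>]) auto
  then obtain t A where A: "\<And>j. j \<in> {1..m} \<Longrightarrow> finite (A j)"
      "\<And>j. j \<in> {1..m} \<Longrightarrow> A j \<subseteq> int_span \<omega> \<inter> cball (t j) (h j / 2)"
      "\<And>j. j \<in> {1..m} \<Longrightarrow> pi * (h j / 2)\<^sup>2 / Im \<omega> \<le> card (A j)"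
    by metis
  \<comment> \<open>Elements of \<open>B\<close> are extensional, so two different ones differ at
    some index in \<open>{1..m}\<close>.\<close>
  define B where "B = (\<Pi>\<^sub>E j\<in>{1..m}. A j)"
  have "finite B" using A(1) by (auto simp: B_def intro: finite_PiE)
  have prod_eq: "(\<Prod>j=1..m. pi * (h j / 2)\<^sup>2 / Im \<omega>) = (pi / (4 * Im \<omega>)) ^ m * (\<Prod>j=1..m. h j)\<^sup>2"
  proof -
    have "(\<Prod>j=1..m. pi * (h j / 2)\<^sup>2 / Im \<omega>) = (\<Prod>j=1..m. (pi / (4 * Im \<omega>)) * (h j)\<^sup>2)"
      by (simp add: power_divide field_simps)
    also have "\<dots> = (pi / (4 * Im \<omega>)) ^ m * (\<Prod>j=1..m. h j)\<^sup>2"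
      by (simp only: prod.distrib prod_power_distrib) simp
    finally show ?thesis .
  qed
  have R2: "R\<^sup>2 = (4 * Im \<omega> / pi) ^ (m + 1) / (\<Prod>j=1..m. h j)\<^sup>2"
  proof -
    have "(2 * sqrt (Im \<omega>) / sqrt pi)\<^sup>2 = 4 * Im \<omega> / pi"
      using \<omega> by (simp add: power_mult_distrib power_divide)
    then have "((2 * sqrt (Im \<omega>) / sqrt pi) ^ (m + 1))\<^sup>2 = (4 * Im \<omega> / pi) ^ (m + 1)"
      by (metis power_mult mult.commute)
    then show ?thesis unfolding R_def by (simp only: power_mult_distrib power_divide) simp
  qed
  \<comment> \<open>This equality fixes the constant in \<open>R\<close>: the factor
    \<open>(pi / (4 * Im \<omega>)) ^ m\<close> cancels all but one factor of
    \<open>R\<^sup>2\<close>, leaving (4 Im \<omega> / pi) * (pi / 4).\<close>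
  have "Im \<omega> = (pi / (4 * Im \<omega>)) ^ m * (\<Prod>j=1..m. h j)\<^sup>2 * (pi * (R / 2)\<^sup>2)"
    using \<omega> hprod_pos less_imp_neq[OF hprod_pos] pi_gt_zero
    by (simp del: prod_zero_iff add: power_divide R2 field_simps power_mult_distrib)
  also have "\<dots> \<le> real (card B) * (pi * (R / 2)\<^sup>2)"
  proof (rule mult_right_mono)
    have "(\<Prod>j=1..m. pi * (h j / 2)\<^sup>2 / Im \<omega>) \<le> (\<Prod>j=1..m. real (card (A j)))"
      using A(3) \<omega> by (intro prod_mono) auto
    then show "(pi / (4 * Im \<omega>)) ^ m * (\<Prod>j=1..m. h j)\<^sup>2 \<le> real (card B)"
      by (simp only: prod_eq) (simp add: B_def card_PiE)
  qed simp
  finally obtain x y l where xy: "x \<in> B" "y \<in> B" "l \<in> int_span \<omega>" "x \<noteq> y \<or> l \<noteq> 0"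
      and le: "cmod (l + f x - f y) \<le> R"
    using small_value_lattice_translate[OF \<omega> \<open>finite B\<close> \<open>R \<ge> 0\<close>, of f] by blast
  \<comment> \<open>Two points of a disc of radius \<open>h j / 2\<close> differ by at most
    \<open>h j\<close>, which bounds the coefficients; index 0 is free to hold the lattice translate
    \<open>l\<close>.\<close>
  define \<beta> where "\<beta> = (\<lambda>j. if j = 0 then l else x j - y j)"
  have mem: "x j \<in> A j" "y j \<in> A j" if "j \<in> {1..m}" for j
    using xy that by (auto simp: B_def)
  have "\<beta> j \<in> int_span \<omega>" if "j \<in> {0..m}" for j
    using that xy(3) mem[of j] A(2)[of j] by (auto simp: \<beta>_def intro!: int_span_diff)
  moreover have "\<exists>j\<in>{0..m}. \<beta> j \<noteq> 0"
  proof (cases "l = 0")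
    case True
    then have "x \<noteq> y" using xy by simp
    then obtain j where "j \<in> {1..m}" "x j \<noteq> y j"
      using xy(1,2) PiE_ext[of x "{1..m}" A y] unfolding B_def by blast
    then show ?thesis by (intro bexI[of _ j]) (auto simp: \<beta>_def)
  qed (auto simp: \<beta>_def)
  moreover have "cmod (\<beta> j) \<le> h j" if j: "j \<in> {1..m}" for j
  proof -
    have "dist (t j) (x j) \<le> h j / 2" "dist (t j) (y j) \<le> h j / 2"
      using mem[OF j] A(2)[OF j] by auto
    then have "dist (x j) (y j) \<le> h j"
      using dist_triangle2[of "x j" "y j" "t j"] by (simp add: dist_commute)
    then show ?thesis using j by (simp add: \<beta>_def dist_norm)
  qed
  moreover have "\<beta> 0 + (\<Sum>j=1..m. \<beta> j * \<Theta> j) = l + f x - f y"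
    by (simp add: \<beta>_def f_def sum_subtractf left_diff_distrib)
  ultimately show ?thesis using le unfolding R_def by (intro exI[of _ \<beta>]) auto
qed

section \<open>Lattices of imaginary quadratic integers\<close>

lemma of_int_in_subfield:
  assumes "is_subfield K"
  shows "of_int a \<in> K"
proof -
  have nat: "of_nat n \<in> K" for n
    using assms by (induction n) (auto simp: is_subfield_def)
  show ?thesis
    using assms nat by (cases a rule: int_cases2) (auto simp: is_subfield_def)
qed

lemma int_span_subset_rat_adjoin:
  assumes "\<omega> \<in> rat_adjoin \<alpha>"
  shows "int_span \<omega> \<subseteq> rat_adjoin \<alpha>"
proof -
  have "lat_pt \<omega> p \<in> K" if "is_subfield K" "\<omega> \<in> K" for p K
    using of_int_in_subfield[OF that(1)] that unfolding lat_pt_def is_subfield_def by metis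
  then show ?thesis
    using assms by (auto simp: rat_adjoin_def int_span_def)
qed

lemma algebraic_int_quadratic:
  fixes x :: complex
  assumes "x\<^sup>2 + of_int b * x + of_int c = 0"
  shows "algebraic_int x"
proof (rule algebraic_int.intros)
  let ?p = "[:of_int c, of_int b, 1 :: complex:]"
  show "lead_coeff ?p = 1" by simp
  show "\<forall>i. coeff ?p i \<in> \<int>" by (auto simp: coeff_pCons split: nat.splits)
  show "poly ?p x = 0" using assms by (simp add: algebra_simps power2_eq_square)
qed

text \<open>The lattice need not be the full ring of integers, since \<open>D\<close> may have square factors.\<close>

lemma int_span_subset_ring_of_integers:
  assumes \<omega>: "\<omega>\<^sup>2 = of_int p * \<omega> - of_int q" "\<omega> \<in> rat_adjoin \<alpha>"
  shows "int_span \<omega> \<subseteq> ring_of_integers (rat_adjoin \<alpha>)"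
proof
  fix x assume x: "x \<in> int_span \<omega>"
  then obtain a b where ab: "x = of_int a + of_int b * \<omega>"
    by (auto simp: int_span_def lat_pt_def)
  \<comment> \<open>The coefficients are minus the trace and the norm of a + b\<omega>, where
    \<omega> and its conjugate root have sum p and product q.\<close>
  have "x\<^sup>2 + of_int (- 2 * a - b * p) * x + of_int (a\<^sup>2 + a * b * p + b\<^sup>2 * q) =
      of_int b ^ 2 * (\<omega>\<^sup>2 - (of_int p * \<omega> - of_int q))"
    by (simp add: ab power2_eq_square algebra_simps)
  also have "\<dots> = 0" by (simp add: \<omega>)
  finally have "algebraic_int x" by (rule algebraic_int_quadratic)
  then show "x \<in> ring_of_integers (rat_adjoin \<alpha>)"
    using x int_span_subset_rat_adjoin[OF \<omega>(2)] by (auto simp: ring_of_integers_def)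
qed

text \<open>Here \<open>tau\<close> arises. The root s of -D gives covolume \<open>sqrt D\<close>;
  for D congruent to 3 modulo 4 the element (1 + s)/2 is also integral and halves the covolume,
  which divides \<open>2 * sqrt (Im \<omega>)\<close> by the square root of 2.\<close>

lemma imag_quadratic_lattice:
  assumes "D > 0" and "D mod 4 \<noteq> 0"
  shows "\<exists>\<omega>. Im \<omega> > 0 \<and> 2 * sqrt (Im \<omega>) = 2 powr tau D * real D powr (1 / 4) \<and>
    int_span \<omega> \<subseteq> ring_of_integers (imag_quadratic_field D)"
proof -
  define s where "s = csqrt (- of_nat D)"
  have s2: "s\<^sup>2 = - of_nat D" unfolding s_def by (rule power2_csqrt)
  have s: "s = \<i> * sqrt (real D)"
    unfolding s_def using assms(1) by (simp add: csqrt_of_real_nonpos[of "- real D", simplified])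
  have s_mem: "s \<in> rat_adjoin s" by (auto simp: rat_adjoin_def)
  have root4: "sqrt (sqrt (real D)) = real D powr (1 / 4)"
    using assms(1) by (simp add: powr_half_sqrt[symmetric] powr_powr)
  show ?thesis
  proof (cases "D mod 4 = 3")
    case False
    then have tau: "tau D = 1" using assms(2) by (simp add: tau_def) presburger
    have "Im s = sqrt (real D)" by (simp add: s)
    moreover have "int_span s \<subseteq> ring_of_integers (imag_quadratic_field D)"
      unfolding imag_quadratic_field_def s_def[symmetric]
      using s2 s_mem by (intro int_span_subset_ring_of_integers[of _ 0 "int D"]) auto
    ultimately show ?thesis using assms(1) tau root4 by (intro exI[of _ s]) auto
  next
    case True
    then have tau: "tau D = 1 / 2" by (simp add: tau_def)
    define \<omega> where "\<omega> = (1 + s) / 2"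
    obtain k where k: "D = 4 * k + 3" using True by (metis mult_div_mod_eq)
    \<comment> \<open>The trace is 1 and the norm is (1 + D)/4 = k + 1, an integer because D = 4k +
      3.\<close>
    have "\<omega>\<^sup>2 = of_int 1 * \<omega> - of_int (int k + 1)"
    proof -
      have "4 * (\<omega>\<^sup>2 - \<omega>) = s\<^sup>2 - 1" by (simp add: \<omega>_def power2_eq_square field_simps)
      also have "\<dots> = 4 * (- of_nat k - 1)" by (simp add: s2 k)
      finally have "\<omega>\<^sup>2 - \<omega> = - of_nat k - 1" by (simp only: mult_cancel_left) simp
      then show ?thesis by (simp add: algebra_simps)
    qed
    moreover have "\<omega> \<in> rat_adjoin s"
    proof -
      have "\<omega> \<in> K" if "is_subfield K" "s \<in> K" for K
      proof -
        have "of_int 2 \<in> K" by (rule of_int_in_subfield[OF that(1)])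
        then have "inverse (of_int 2) \<in> K" "1 + s \<in> K" using that by (simp_all only: is_subfield_def)
        then have "(1 + s) * inverse (of_int 2) \<in> K" using that by (simp only: is_subfield_def)
        then show ?thesis by (simp add: \<omega>_def field_simps)
      qed
      then show ?thesis by (auto simp: rat_adjoin_def)
    qed
    ultimately have "int_span \<omega> \<subseteq> ring_of_integers (imag_quadratic_field D)"
      unfolding imag_quadratic_field_def s_def[symmetric]
      by (rule int_span_subset_ring_of_integers)
    moreover have Im: "Im \<omega> = sqrt (real D) / 2" by (simp add: \<omega>_def s)
    moreover have "Im \<omega> > 0" unfolding Im using assms(1) by simp
    moreover have "2 * sqrt (Im \<omega>) = 2 powr tau D * real D powr (1 / 4)"
      using root4 by (simp add: Im tau real_sqrt_divide powr_half_sqrt real_div_sqrt field_simps)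
    ultimately show ?thesis by blast
  qed
qed

theorem theorem2:
  fixes D m :: nat and \<Theta> :: "nat \<Rightarrow> complex" and H :: "nat \<Rightarrow> nat"
  assumes "D > 0" and "D mod 4 \<noteq> 0"
    and "\<And>j. j \<in> {1..m} \<Longrightarrow> H j \<ge> 1"
  shows "\<exists>\<beta> :: nat \<Rightarrow> complex.
      (\<forall>j\<in>{0..m}. \<beta> j \<in> ring_of_integers (imag_quadratic_field D)) \<and>
      (\<exists>j\<in>{0..m}. \<beta> j \<noteq> 0) \<and>
      (\<forall>j\<in>{1..m}. cmod (\<beta> j) \<le> real (H j)) \<and>
      cmod (\<beta> 0 + (\<Sum>j=1..m. \<beta> j * \<Theta> j))
        \<le> (2 powr tau D * real D powr (1 / 4) / sqrt pi) ^ (m + 1)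
           * (1 / (\<Prod>j=1..m. real (H j)))"
proof -
  obtain \<omega> where \<omega>: "Im \<omega> > 0" "2 * sqrt (Im \<omega>) = 2 powr tau D * real D powr (1 / 4)"
      "int_span \<omega> \<subseteq> ring_of_integers (imag_quadratic_field D)"
    using imag_quadratic_lattice[OF assms(1,2)] by blast
  have "real (H j) > 0" if "j \<in> {1..m}" for j
    using assms(3)[OF that] by simp
  \<comment> \<open>Working in the lattice suffices: it lies in the ring of integers, and
    \<open>2 * sqrt (Im \<omega>)\<close> is exactly the numerator of the claimed constant.\<close>
  from linear_form_small_value[OF \<omega>(1), of m "\<lambda>j. real (H j)" \<Theta>, OF this]
  show ?thesis unfolding \<omega>(2) using \<omega>(3) by blast
qed

end
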